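(* Let $\ell\ge1$ be an integer and let $\mathcal{T}^\ell$ represent $\ell$ iterations of the projected gradient method. Consider the optimizer dynamics $z_k=\mathcal{T}^\ell(z_{k-1},x_k)$, $k\ge1$, driven by a sequence $\{x_k\}_{k\ge0}\subset\mathbb{R}^n$, with $z_0\in\mathbb{R}^{Nm}$. Then the error signal $e_k=z_k-S(x_k)$ is input-to-state stable with respect to $\Delta x_k=x_{k+1}-x_k$, i.e., for all $k\ge0$, $$\|e_k\|\le \eta^{k\ell}\|e_0\|+\gamma_2(\ell)\,\sup_{k\ge0}\|G\Delta x_k\|_{H^{-1}},$$ where $\gamma_2(\ell)=b\,\eta^\ell/(1-\eta^\ell)$, $b=\|H^{-1/2}\|$ and $\eta=(\kappa(H)-1)/(\kappa(H)+1)$. Moreover, $$\limsup_{k\to\infty}\|e_k\|\le\gamma_2(\ell)\,\limsup_{k\to\infty}\|G\Delta x_k\|_{H^{-1}} .$$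
   Context: Notation: $\mathbb{S}_{++}^d$ is the set of symmetric positive definite $d\times d$ real matrices; $\|x\|_M=\sqrt{x^TMx}$; $\|\cdot\|$ without subscript is the Euclidean norm (induced $2$-norm for matrices); $\lambda^-(H),\lambda^+(H)$ are the minimum and maximum eigenvalues and $\kappa(H)=\lambda^+(H)/\lambda^-(H)$; $(x,y)$ denotes the stacked vector. Setting: $n,m,N\ge1$ are integers, $A\in\mathbb{R}^{n\times n}$, $B\in\mathbb{R}^{n\times m}$. Standing assumptions: (1) $(A,B)$ is stabilizable, $R\in\mathbb{S}_{++}^m$, $Q\in\mathbb{S}_{++}^n$, and $P\in\mathbb{S}_{++}^n$ satisfies $P=Q+A^TPA-(A^TPB)(R+B^TPB)^{-1}(B^TPA)$; (2) $\mathcal{U}\subseteq\mathbb{R}^m$ is closed, convex and contains the origin in its interior. Let $\hat A\in\mathbb{R}^{(N+1)n\times n}$ be the block column with blocks $I,A,\dots,A^N$; let $\hat B\in\mathbb{R}^{(N+1)n\times Nm}$ be the block matrix whose block $(i,j)$, $i=0,\dots,N$, $j=0,\dots,N-1$, is $A^{i-1-j}B$ if $j\le i-1$ and $0$ otherwise; $\hat H=\mathrm{blkdiag}(I_N\otimes Q,\,P)$. Set $H=\hat B^T\hat H\hat B+I_N\otimes R$, $G=\hat B^T\hat H\hat A$, $W=\hat A^T\hat H\hat A$, $M=\begin{bmatrix}H&G\\ G^T&W\end{bmatrix}$. Let $\mathcal{Z}=\mathcal{U}\times\cdots\times\mathcal{U}$ ($N$ copies), $f(z,x)=\|(z,x)\|_M^2$,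 and let $S(x)$ be the unique minimizer of $f(\cdot,x)$ over $\mathcal{Z}$. Projected gradient method: $\mathcal{T}(z,x)=\Pi_{\mathcal{Z}}[z-\alpha\nabla_zf(z,x)]$ with $\alpha=1/(\lambda^+(H)+\lambda^-(H))$ and $\Pi_{\mathcal{Z}}$ the Euclidean projection onto $\mathcal{Z}$; $\mathcal{T}^0(z,x)=z$ and $\mathcal{T}^\ell(z,x)=\mathcal{T}(\mathcal{T}^{\ell-1}(z,x),x)$. *)

theory Defs
  imports "HOL-Analysis.Analysis"
begin

section \<open>Matrices\<close>

text \<open>The instance of \<^class>\<open>power\<close> on vectors of vectors is componentwise, hence a separate
  power for matrices.\<close>

definition matrix_power :: "'a::semiring_1^'n^'n \<Rightarrow> nat \<Rightarrow> 'a^'n^'n" where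
  "matrix_power A k = (((**) A) ^^ k) (mat 1)"

definition pos_def :: "real^'n^'n \<Rightarrow> bool" where
  "pos_def X \<longleftrightarrow> transpose X = X \<and> (\<forall>v. v \<noteq> 0 \<longrightarrow> v \<bullet> (X *v v) > 0)"

definition wnorm :: "real^'n^'n \<Rightarrow> real^'n \<Rightarrow> real" where
  "wnorm X v = sqrt (v \<bullet> (X *v v))"

definition eigenvalues :: "'a::field^'n^'n \<Rightarrow> 'a set" where
  "eigenvalues X = {c. \<exists>v. v \<noteq> 0 \<and> X *v v = c *s v}"

definition lambda_min :: "real^'n^'n \<Rightarrow> real" where
  "lambda_min X = Min (eigenvalues X)"

definition lambda_max :: "real^'n^'n \<Rightarrow> real" where
  "lambda_max X = Max (eigenvalues X)"

definition cond_number :: "real^'n^'n \<Rightarrow> real" where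
  "cond_number X = lambda_max X / lambda_min X"

text \<open>The square root of a positive definite matrix; not meant for other arguments.\<close>

definition matrix_sqrt :: "real^'n^'n \<Rightarrow> real^'n^'n" where
  "matrix_sqrt X = (THE Y. pos_def Y \<and> Y ** Y = X)"

definition norm2 :: "real^'n^'m \<Rightarrow> real" where
  "norm2 X = onorm ((*v) X)"

definition kronecker :: "real^'b^'a \<Rightarrow> real^'d^'c \<Rightarrow> real^('b \<times> 'd)^('a \<times> 'c)" where
  "kronecker X Y = (\<chi> p q. X $ fst p $ fst q * Y $ snd p $ snd q)"

definition stack :: "real^'a \<Rightarrow> real^'b \<Rightarrow> real^('a + 'b)" where
  "stack v w = (\<chi> i. case i of Inl a \<Rightarrow> v $ a | Inr b \<Rightarrow> w $ b)"

definition block2 ::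
  "real^'a^'a \<Rightarrow> real^'b^'a \<Rightarrow> real^'a^'b \<Rightarrow> real^'b^'b \<Rightarrow> real^('a + 'b)^('a + 'b)" where
  "block2 X11 X12 X21 X22 = (\<chi> p q.
     case p of
       Inl a \<Rightarrow> (case q of Inl c \<Rightarrow> X11 $ a $ c | Inr d \<Rightarrow> X12 $ a $ d)
     | Inr b \<Rightarrow> (case q of Inl c \<Rightarrow> X21 $ b $ c | Inr d \<Rightarrow> X22 $ b $ d))"


section \<open>Stabilizability and the Riccati equation\<close>

definition complexify :: "real^'n^'m \<Rightarrow> complex^'n^'m" where
  "complexify X = (\<chi> i j. complex_of_real (X $ i $ j))"

definition schur_stable :: "real^'n^'n \<Rightarrow> bool" where
  "schur_stable X \<longleftrightarrow> (\<forall>c \<in> eigenvalues (complexify X). norm c < 1)"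

definition stabilizable :: "real^'n^'n \<Rightarrow> real^'m^'n \<Rightarrow> bool" where
  "stabilizable A B \<longleftrightarrow> (\<exists>K :: real^'n^'m. schur_stable (A + B ** K))"

definition riccati ::
  "real^'n^'n \<Rightarrow> real^'m^'n \<Rightarrow> real^'n^'n \<Rightarrow> real^'m^'m \<Rightarrow> real^'n^'n \<Rightarrow> bool" where
  "riccati A B Q R P \<longleftrightarrow>
     P = Q + transpose A ** P ** A
         - (transpose A ** P ** B) ** matrix_inv (R + transpose B ** P ** B) ** (transpose B ** P ** A)"


section \<open>The condensed quadratic program\<close>

text \<open>The horizon \<open>N\<close> is \<open>CARD('N)\<close> for a finite linearly ordered type \<open>'N\<close>, whose elements, in
  increasing order, are the stages \<open>0, \<dots>, N - 1\<close>. The \<open>N + 1\<close> stages of the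
  predicted state are indexed by \<open>'N option\<close>: \<open>Some j\<close> has the same number as \<open>j\<close>, and \<open>None\<close>
  is the terminal stage \<open>N\<close>. A stacked vector has a pair (stage, component) as index.\<close>

definition stage :: "'N::{finite,linorder} \<Rightarrow> nat" where
  "stage j = card {i. i < j}"

definition state_stage :: "'N::{finite,linorder} option \<Rightarrow> nat" where
  "state_stage i = (case i of Some j \<Rightarrow> stage j | None \<Rightarrow> CARD('N))"

definition A_hat :: "real^'n^'n \<Rightarrow> real^'n^('N::{finite,linorder} option \<times> 'n)" where
  "A_hat A = (\<chi> p c. matrix_power A (state_stage (fst p)) $ snd p $ c)"

definition B_hat ::
  "real^'n^'n \<Rightarrow> real^'m^'n \<Rightarrow> real^('N::{finite,linorder} \<times> 'm)^('N option \<times> 'n)" where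
  "B_hat A B = (\<chi> p q.
     let i = state_stage (fst p); j = stage (fst q)
     in if j < i then (matrix_power A (i - 1 - j) ** B) $ snd p $ snd q else 0)"

definition H_hat ::
  "real^'n^'n \<Rightarrow> real^'n^'n \<Rightarrow> real^('N::{finite,linorder} option \<times> 'n)^('N option \<times> 'n)" where
  "H_hat Q P = (\<chi> p q.
     if fst p = fst q then (if fst p = None then P else Q) $ snd p $ snd q else 0)"

definition qp_H ::
  "real^'n^'n \<Rightarrow> real^'m^'n \<Rightarrow> real^'n^'n \<Rightarrow> real^'m^'m \<Rightarrow> real^'n^'n
     \<Rightarrow> real^('N::{finite,linorder} \<times> 'm)^('N \<times> 'm)" where
  "qp_H A B Q R P = transpose (B_hat A B) ** H_hat Q P ** B_hat A B + kronecker (mat 1) R"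

definition qp_G ::
  "real^'n^'n \<Rightarrow> real^'m^'n \<Rightarrow> real^'n^'n \<Rightarrow> real^'n^'n
     \<Rightarrow> real^'n^('N::{finite,linorder} \<times> 'm)" where
  "qp_G A B Q P = transpose (B_hat A B) ** H_hat Q P ** A_hat A"

text \<open>The horizon does not occur in the type of the result here, so it is passed as a type
  argument.\<close>

definition qp_W ::
  "'N::{finite,linorder} itself \<Rightarrow> real^'n^'n \<Rightarrow> real^'n^'n \<Rightarrow> real^'n^'n \<Rightarrow> real^'n^'n" where
  "qp_W TYPE('N) A Q P =
     transpose (A_hat A :: real^'n^('N option \<times> 'n)) ** H_hat Q P ** A_hat A"

definition qp_M ::
  "real^'n^'n \<Rightarrow> real^'m^'n \<Rightarrow> real^'n^'n \<Rightarrow> real^'m^'m \<Rightarrow> real^'n^'n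
     \<Rightarrow> real^(('N::{finite,linorder} \<times> 'm) + 'n)^(('N \<times> 'm) + 'n)" where
  "qp_M A B Q R P =
     block2 (qp_H A B Q R P) (qp_G A B Q P)
            (transpose (qp_G A B Q P)) (qp_W TYPE('N) A Q P)"

definition cost ::
  "real^'n^'n \<Rightarrow> real^'m^'n \<Rightarrow> real^'n^'n \<Rightarrow> real^'m^'m \<Rightarrow> real^'n^'n
     \<Rightarrow> real^('N::{finite,linorder} \<times> 'm) \<Rightarrow> real^'n \<Rightarrow> real" where
  "cost A B Q R P z x = (wnorm (qp_M A B Q R P) (stack z x))\<^sup>2"

definition input_sequences :: "(real^'m) set \<Rightarrow> (real^('N::finite \<times> 'm)) set" where
  "input_sequences U = {z. \<forall>i. (\<chi> c. z $ (i, c)) \<in> U}"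

definition minimizer :: "('a \<Rightarrow> 'b \<Rightarrow> real) \<Rightarrow> 'a set \<Rightarrow> 'b \<Rightarrow> 'a" where
  "minimizer f Z x = (THE z. is_arg_min (\<lambda>w. f w x) (\<lambda>w. w \<in> Z) z)"


section \<open>The projected gradient method\<close>

definition gradient :: "('a::real_inner \<Rightarrow> real) \<Rightarrow> 'a \<Rightarrow> 'a" where
  "gradient g z = (THE D. GDERIV g z :> D)"

definition proj_grad_step ::
  "real \<Rightarrow> ('a::euclidean_space \<Rightarrow> 'b \<Rightarrow> real) \<Rightarrow> 'a set \<Rightarrow> 'a \<Rightarrow> 'b \<Rightarrow> 'a" where
  "proj_grad_step \<alpha> f Z z x = closest_point Z (z - \<alpha> *\<^sub>R gradient (\<lambda>w. f w x) z)"

definition proj_grad ::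
  "nat \<Rightarrow> real \<Rightarrow> ('a::euclidean_space \<Rightarrow> 'b \<Rightarrow> real) \<Rightarrow> 'a set \<Rightarrow> 'a \<Rightarrow> 'b \<Rightarrow> 'a" where
  "proj_grad l \<alpha> f Z z x = ((\<lambda>w. proj_grad_step \<alpha> f Z w x) ^^ l) z"


section \<open>Input-to-state stability\<close>

definition class_K :: "(real \<Rightarrow> real) \<Rightarrow> bool" where
  "class_K \<gamma> \<longleftrightarrow> continuous_on {0..} \<gamma> \<and> strict_mono_on {0..} \<gamma> \<and> \<gamma> 0 = 0"

definition class_KL :: "(real \<Rightarrow> nat \<Rightarrow> real) \<Rightarrow> bool" where
  "class_KL \<beta> \<longleftrightarrow> (\<forall>k. class_K (\<lambda>s. \<beta> s k)) \<and> (\<forall>s\<ge>0. decseq (\<beta> s) \<and> \<beta> s \<longlonglongrightarrow> 0)"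

text \<open>Stability is a property of a system, given here by the set of its pairs (state trajectory,
  input sequence); the comparison functions are uniform over this set. As usual, only bounded
  inputs are considered.\<close>

definition input_to_state_stable ::
  "((nat \<Rightarrow> 'a::real_normed_vector) \<times> (nat \<Rightarrow> 'b::real_normed_vector)) set \<Rightarrow> bool" where
  "input_to_state_stable T \<longleftrightarrow>
     (\<exists>\<beta> \<gamma>. class_KL \<beta> \<and> class_K \<gamma> \<and>
        (\<forall>(e, d) \<in> T. bounded (range d) \<longrightarrow>
           (\<forall>k. norm (e k) \<le> \<beta> (norm (e 0)) k + \<gamma> (SUP j. norm (d j)))))"

end

theory Submission
  imports Defs
begin

text \<open>
  Eliminating the predicted states turns the optimal control problem into the minimization of
  \<open>z \<bullet> (H *v z) + 2 * (z \<bullet> (G *v x))\<close>, up to a term independent of \<open>z\<close>, over a closed convex set, with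
  \<open>H\<close> positive definite (\<open>cost_eq_quadratic\<close>, \<open>pos_def_qp_H\<close>). Two facts about such problems carry the
  proof.

  The first is that a projected gradient step contracts. The projection is nonexpansive, and the
  linear part of the step has, by the spectral theorem, norm at most
  \<open>\<eta> = (cond_number H - 1) / (cond_number H + 1)\<close> (\<open>gradient_step_contraction\<close>). The optimizer is its
  fixed point, so \<open>l\<close> steps reduce the distance to the optimizer by the factor \<open>\<eta> ^ l\<close>
  (\<open>qp_step_funpow_contraction\<close>).

  The second is that the optimizer moves slowly. Comparing the variational inequalities at two
  parameters bounds the displacement of \<open>S\<close> in the \<open>H\<close>-norm by that of \<open>G *v x\<close> in the dual norm
  (\<open>solution_lipschitz\<close>); passing to the Euclidean norm costs the factor \<open>b\<close> (\<open>norm_le_wnorm\<close>).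

  Together, with \<open>w k\<close> the dual norm of \<open>G *v dx x k\<close>, these give the scalar recursion
  \<open>norm (e (k + 1)) \<le> \<eta> ^ l * (norm (e k) + b * w k)\<close>. Its input term equals
  \<open>(1 - \<eta> ^ l) * (\<gamma>2 * w k)\<close>, so the error is attracted to the level \<open>\<gamma>2 * w\<close>. The uniform and the
  asymptotic bound are the two readings of this (\<open>contraction_recursion\<close>,
  \<open>limsup_contraction_recursion\<close>), and input-to-state stability follows since \<open>w k\<close> is at most a constant
  times the norm of \<open>dx x k\<close> (\<open>input_to_state_stableI\<close>).
\<close>

section \<open>Spectral theorem for symmetric matrices\<close>

lemma symmetric_inner:
  fixes X :: "real^'n^'n"
  assumes "transpose X = X"
  shows "u \<bullet> (X *v v) = (X *v u) \<bullet> v"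
  by (metis assms dot_lmul_matrix transpose_matrix_vector)

lemma linear_coefficient_zero:
  fixes a c :: real
  assumes "\<And>t. 0 \<le> a * t + c * t\<^sup>2"
  shows "a = 0"
proof (rule ccontr)
  assume "a \<noteq> 0"
  \<comment> \<open>At \<open>t = - a * s\<close> with \<open>c * s < 1\<close> the linear term outweighs the quadratic one.\<close>
  define s where "s = 1 / (\<bar>c\<bar> + 1)"
  have s: "s > 0" "c * s < 1"
    unfolding s_def by (auto simp: divide_simps)
  have "0 \<le> a * (- a * s) + c * (- a * s)\<^sup>2"
    by (rule assms)
  also have "\<dots> = a\<^sup>2 * s * (c * s - 1)"
    by (simp add: power2_eq_square algebra_simps)
  finally have "0 \<le> a\<^sup>2 * s * (c * s - 1)" .
  moreover have "a\<^sup>2 * s > 0" using s \<open>a \<noteq> 0\<close> by simp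
  ultimately show False using s(2)
    by (simp add: zero_le_mult_iff)
qed

text \<open>A maximizer \<open>u\<close> of the Rayleigh quotient over the unit sphere of the subspace is an eigenvector:
  with \<open>c\<close> the maximum, the form \<open>v \<bullet> (c v - X v)\<close> is nonnegative on the subspace and vanishes at
  \<open>u\<close>, so its first variation at \<open>u\<close>, twice the pairing with \<open>c u - X u\<close>, vanishes. Since
  \<open>c u - X u\<close> itself lies in the invariant subspace, it is an admissible direction.\<close>

lemma symmetric_eigenvector_in_invariant_subspace:
  fixes X :: "real^'n^'n"
  assumes sym: "transpose X = X" and V: "subspace V" and w: "w \<in> V" "w \<noteq> 0"
    and inv: "\<And>v. v \<in> V \<Longrightarrow> X *v v \<in> V"
  obtains u where "u \<in> V" "norm u = 1" "X *v u = (u \<bullet> (X *v u)) *\<^sub>R u"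
proof -
  let ?K = "sphere 0 1 \<inter> V"
  have "compact ?K"
    by (intro compact_Int_closed closed_subspace V) simp
  moreover have "(1 / norm w) *\<^sub>R w \<in> ?K"
    using w V by (auto simp: subspace_scale)
  moreover have "continuous_on ?K (\<lambda>v. v \<bullet> (X *v v))"
    by (intro continuous_intros linear_continuous_on matrix_vector_mul_bounded_linear)
  ultimately obtain u where u: "u \<in> ?K" and umax: "\<And>v. v \<in> ?K \<Longrightarrow> v \<bullet> (X *v v) \<le> u \<bullet> (X *v u)"
    using continuous_attains_sup[of ?K "\<lambda>v. v \<bullet> (X *v v)"] by blast
  define c where "c = u \<bullet> (X *v u)"
  have uu: "u \<bullet> u = 1" and nu: "norm u = 1" and uV: "u \<in> V"
    using u by (auto simp: norm_eq_1)
  have le: "v \<bullet> (X *v v) \<le> c * (v \<bullet> v)" if "v \<in> V" for v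
  proof (cases "v = 0")
    case False
    have "(1 / norm v) *\<^sub>R v \<in> ?K"
      using that False V by (auto simp: subspace_scale)
    from umax[OF this] have "(1 / norm v) * ((1 / norm v) * (v \<bullet> (X *v v))) \<le> c"
      by (simp add: c_def matrix_vector_mult_scaleR)
    moreover have "norm v * norm v > 0" using False by simp
    ultimately show ?thesis
      using False by (simp add: divide_simps power2_norm_eq_inner[symmetric] power2_eq_square)
  qed simp
  define h where "h = c *\<^sub>R u - X *v u"
  have hV: "h \<in> V"
    unfolding h_def using V uV inv by (intro subspace_diff subspace_scale) auto
  have "0 \<le> (2 * (h \<bullet> h)) * t + (c * (h \<bullet> h) - h \<bullet> (X *v h)) * t\<^sup>2" for t
  proof -
    have "u + t *\<^sub>R h \<in> V"
      using V uV hV by (intro subspace_add subspace_scale)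
    from le[OF this] have
      "0 \<le> c * ((u + t *\<^sub>R h) \<bullet> (u + t *\<^sub>R h)) - (u + t *\<^sub>R h) \<bullet> (X *v (u + t *\<^sub>R h))"
      by simp
    also have "\<dots> = c * (u \<bullet> u) - u \<bullet> (X *v u) + 2 * t * (h \<bullet> (c *\<^sub>R u - X *v u))
        + (c * (h \<bullet> h) - h \<bullet> (X *v h)) * t\<^sup>2"
      using symmetric_inner[OF sym, of u h]
      by (simp add: matrix_vector_right_distrib matrix_vector_mult_scaleR inner_simps
          power2_eq_square inner_commute algebra_simps)
    also have "\<dots> = (2 * (h \<bullet> h)) * t + (c * (h \<bullet> h) - h \<bullet> (X *v h)) * t\<^sup>2"
      by (simp add: uu c_def[symmetric] h_def[symmetric])
    finally show ?thesis .
  qed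
  then have "2 * (h \<bullet> h) = 0"
    by (rule linear_coefficient_zero)
  then have "X *v u = c *\<^sub>R u"
    by (simp add: h_def)
  then show ?thesis
    using that[of u] uV nu by (simp add: c_def)
qed

text \<open>The eigenvalue of a unit eigenvector \<open>u\<close> is written as \<open>u \<bullet> (X *v u)\<close>, which avoids a separate
  function from basis vectors to eigenvalues, and completeness is stated as the expansion formula,
  the form in which it is applied.\<close>

definition eigenbasis :: "real^'n^'n \<Rightarrow> (real^'n) set \<Rightarrow> bool" where
  "eigenbasis X E \<longleftrightarrow> finite E \<and>
     (\<forall>u\<in>E. \<forall>w\<in>E. u \<bullet> w = (if u = w then 1 else 0)) \<and>
     (\<forall>u\<in>E. X *v u = (u \<bullet> (X *v u)) *\<^sub>R u) \<and>
     (\<forall>v. v = (\<Sum>u\<in>E. (u \<bullet> v) *\<^sub>R u))"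

text \<open>An orthonormal set of eigenvectors of maximal size must be complete: its orthogonal complement
  is invariant under the symmetric matrix, so if it were nonzero, it would contain another unit
  eigenvector.\<close>

theorem spectral_theorem:
  fixes X :: "real^'n^'n"
  assumes sym: "transpose X = X"
  obtains E where "eigenbasis X E"
proof -
  define C where "C = {E :: (real^'n) set.
     (\<forall>u\<in>E. \<forall>w\<in>E. u \<bullet> w = (if u = w then 1 else 0)) \<and> (\<forall>u\<in>E. X *v u = (u \<bullet> (X *v u)) *\<^sub>R u)}"
  have bound: "finite E \<and> card E \<le> DIM(real^'n)" if "E \<in> C" for E
  proof -
    have orth: "u \<bullet> w = (if u = w then 1 else 0)" if "u \<in> E" "w \<in> E" for u w
      using \<open>E \<in> C\<close> that unfolding C_def by blast
    have "pairwise orthogonal E"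
      by (simp add: pairwise_def orthogonal_def orth)
    moreover have "0 \<notin> E"
      using orth[of 0 0] by auto
    ultimately
    show ?thesis
      using pairwise_orthogonal_independent independent_bound by blast
  qed
  have "{} \<in> C" by (simp add: C_def)
  moreover have "\<forall>E. E \<in> C \<longrightarrow> card E \<le> DIM(real^'n)"
    using bound by blast
  ultimately have "\<exists>E. E \<in> C \<and> (\<forall>F. F \<in> C \<longrightarrow> card F \<le> card E)"
    using ex_has_greatest_nat[of "\<lambda>E. E \<in> C" "{}" card "Suc (DIM(real^'n))"] by (auto simp: less_Suc_eq_le)
  then obtain E where E: "E \<in> C" and Emax: "\<And>F. F \<in> C \<Longrightarrow> card F \<le> card E"
    by (elim exE conjE) simp
  have fin: "finite E" using bound[OF E] by simp
  have orth: "u \<bullet> w = (if u = w then 1 else 0)" if "u \<in> E" "w \<in> E" for u w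
    using E that unfolding C_def by blast
  have eig: "X *v u = (u \<bullet> (X *v u)) *\<^sub>R u" if "u \<in> E" for u
    using E that unfolding C_def by blast
  define V where "V = {v. \<forall>u\<in>E. u \<bullet> v = 0}"
  have V: "subspace V"
    by (auto simp: V_def subspace_def inner_simps)
  have inv: "X *v v \<in> V" if "v \<in> V" for v
  proof -
    have "u \<bullet> (X *v v) = 0" if "u \<in> E" for u
    proof -
      have "u \<bullet> (X *v v) = (u \<bullet> (X *v u)) * (u \<bullet> v)"
        using symmetric_inner[OF sym, of u v]
          arg_cong[OF eig[OF that], of "\<lambda>y. y \<bullet> v"] by (simp only: inner_scaleR_left)
      then show ?thesis using \<open>v \<in> V\<close> that by (simp add: V_def)
    qed
    then show ?thesis by (simp add: V_def)
  qed
  have V0: "v = 0" if "v \<in> V" for v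
  proof (rule ccontr)
    assume "v \<noteq> 0"
    obtain u where u: "u \<in> V" "norm u = 1" "X *v u = (u \<bullet> (X *v u)) *\<^sub>R u"
      by (rule symmetric_eigenvector_in_invariant_subspace[OF sym V \<open>v \<in> V\<close> \<open>v \<noteq> 0\<close> inv])
    have "u \<notin> E"
    proof
      assume "u \<in> E"
      then have "u \<bullet> u = 0" using u(1) by (simp add: V_def)
      then show False using u(2) by simp
    qed
    have "insert u E \<in> C"
    proof -
      have "w \<bullet> u = 0" if "w \<in> E" for w
        using u(1) that by (simp add: V_def)
      moreover have "u \<bullet> w = 0" if "w \<in> E" for w
        using u(1) that inner_commute[of u w] by (simp add: V_def)
      moreover have "u \<bullet> u = 1"
        using u(2) by (simp add: norm_eq_1)
      ultimately have "\<forall>w\<in>insert u E. \<forall>y\<in>insert u E. w \<bullet> y = (if w = y then 1 else 0)"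
        using orth \<open>u \<notin> E\<close> by auto
      moreover have "\<forall>w\<in>insert u E. X *v w = (w \<bullet> (X *v w)) *\<^sub>R w"
        using u(3) eig by blast
      ultimately show ?thesis
        unfolding C_def by blast
    qed
    from Emax[OF this] show False
      using \<open>u \<notin> E\<close> fin by simp
  qed
  have "v = (\<Sum>u\<in>E. (u \<bullet> v) *\<^sub>R u)" for v
  proof -
    have "w \<bullet> (\<Sum>u\<in>E. (u \<bullet> v) *\<^sub>R u) = w \<bullet> v" if "w \<in> E" for w
    proof -
      have "w \<bullet> (\<Sum>u\<in>E. (u \<bullet> v) *\<^sub>R u) = (\<Sum>u\<in>E. if u = w then u \<bullet> v else 0)"
        using that by (auto simp: inner_sum_right orth intro!: sum.cong)
      then show ?thesis
        using that fin by simp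
    qed
    then have "v - (\<Sum>u\<in>E. (u \<bullet> v) *\<^sub>R u) \<in> V"
      by (simp add: V_def inner_simps)
    from V0[OF this] show ?thesis by simp
  qed
  then have "eigenbasis X E"
    unfolding eigenbasis_def using fin orth eig by blast
  then show ?thesis by (rule that)
qed

text \<open>Rewriting with the expansion formula or with the eigenvector equation does not terminate, because
  the left-hand side occurs again on the right. The components are therefore made available
  separately.\<close>

lemma eigenbasisD:
  assumes "eigenbasis X E"
  shows "finite E" "u \<in> E \<Longrightarrow> norm u = 1" "u \<in> E \<Longrightarrow> X *v u = (u \<bullet> (X *v u)) *\<^sub>R u"
    "v = (\<Sum>u\<in>E. (u \<bullet> v) *\<^sub>R u)"
proof -
  note E = assms[unfolded eigenbasis_def]
  show "finite E" by (rule conjunct1[OF E])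
  show "norm u = 1" if "u \<in> E"
  proof -
    have "u \<bullet> u = (if u = u then 1 else 0)" using E that by blast
    then show ?thesis by (simp add: norm_eq_1)
  qed
  show "X *v u = (u \<bullet> (X *v u)) *\<^sub>R u" if "u \<in> E" using E that by blast
  show "v = (\<Sum>u\<in>E. (u \<bullet> v) *\<^sub>R u)" using E by blast
qed

lemma eigenbasis_orthonormal:
  assumes "eigenbasis X E" "u \<in> E" "w \<in> E"
  shows "u \<bullet> w = (if u = w then 1 else 0)"
  using assms unfolding eigenbasis_def by blast

lemma eigenbasis_parseval:
  assumes "eigenbasis X E"
  shows "v \<bullet> w = (\<Sum>u\<in>E. (u \<bullet> v) * (u \<bullet> w))"
proof -
  have "v \<bullet> w = (\<Sum>u\<in>E. (u \<bullet> v) *\<^sub>R u) \<bullet> w"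
    by (rule arg_cong[OF eigenbasisD(4)[OF assms]])
  then show ?thesis by (simp add: inner_sum_left)
qed

lemma eigenbasis_coordinate:
  assumes "eigenbasis X E" "transpose X = X" "u \<in> E"
  shows "u \<bullet> (X *v v) = (u \<bullet> (X *v u)) * (u \<bullet> v)"
proof -
  have eig: "X *v u = (u \<bullet> (X *v u)) *\<^sub>R u"
    by (rule eigenbasisD(3)[OF assms(1,3)])
  have "(X *v u) \<bullet> v = (u \<bullet> (X *v u)) * (u \<bullet> v)"
    using arg_cong[OF eig, of "\<lambda>y. y \<bullet> v"] by (simp only: inner_scaleR_left)
  then show ?thesis
    using symmetric_inner[OF assms(2), of u v] by simp
qed

text \<open>An arbitrary eigenvector has a nonzero coordinate along some \<open>u\<close> in the basis, and comparing this
  coordinate on both sides of the eigenvector equation identifies the eigenvalue with that of \<open>u\<close>.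
  In particular the spectrum is finite, so that \<^const>\<open>lambda_min\<close> and \<^const>\<open>lambda_max\<close> are
  attained.\<close>

lemma eigenvalues_eigenbasis:
  fixes X :: "real^'n^'n"
  assumes E: "eigenbasis X E" and sym: "transpose X = X"
  shows "eigenvalues X = (\<lambda>u. u \<bullet> (X *v u)) ` E"
proof
  show "eigenvalues X \<subseteq> (\<lambda>u. u \<bullet> (X *v u)) ` E"
  proof
    fix c assume "c \<in> eigenvalues X"
    then obtain v where v: "v \<noteq> 0" "X *v v = c *\<^sub>R v"
      by (auto simp: eigenvalues_def scalar_mult_eq_scaleR)
    have "\<exists>u\<in>E. u \<bullet> v \<noteq> 0"
    proof (rule ccontr)
      assume "\<not> ?thesis"
      then have "v \<bullet> v = 0"
        by (simp add: eigenbasis_parseval[OF E, of v v])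
      then show False using v by simp
    qed
    then obtain u where u: "u \<in> E" "u \<bullet> v \<noteq> 0" by blast
    have "c * (u \<bullet> v) = (u \<bullet> (X *v u)) * (u \<bullet> v)"
      using eigenbasis_coordinate[OF E sym u(1), of v] v by simp
    then show "c \<in> (\<lambda>u. u \<bullet> (X *v u)) ` E"
      using u by auto
  qed
  show "(\<lambda>u. u \<bullet> (X *v u)) ` E \<subseteq> eigenvalues X"
  proof
    fix c assume "c \<in> (\<lambda>u. u \<bullet> (X *v u)) ` E"
    then obtain u where u: "u \<in> E" "c = u \<bullet> (X *v u)" by blast
    then have "u \<noteq> 0" "X *v u = c *s u"
      using eigenbasisD(2,3)[OF E u(1)] by (auto simp: scalar_mult_eq_scaleR)
    then show "c \<in> eigenvalues X"
      by (auto simp: eigenvalues_def)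
  qed
qed

lemma eigenbasis_lambda_bounds:
  fixes X :: "real^'n^'n"
  assumes E: "eigenbasis X E" and sym: "transpose X = X" and u: "u \<in> E"
  shows "lambda_min X \<le> u \<bullet> (X *v u)" "u \<bullet> (X *v u) \<le> lambda_max X"
  using eigenbasisD(1)[OF E] u unfolding lambda_min_def lambda_max_def eigenvalues_eigenbasis[OF E sym]
  by simp_all

lemma pos_def_lambda_bounds:
  fixes X :: "real^'n^'n"
  assumes X: "pos_def X"
  shows "0 < lambda_min X" "lambda_min X \<le> lambda_max X"
proof -
  have sym: "transpose X = X" using X by (simp add: pos_def_def)
  obtain E where E: "eigenbasis X E" by (rule spectral_theorem[OF sym])
  have fin: "finite E" by (rule eigenbasisD(1)[OF E])
  have "E \<noteq> {}"
    using eigenbasis_parseval[OF E, of "axis undefined 1" "axis undefined 1"] by auto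
  have "lambda_min X \<in> eigenvalues X"
    unfolding lambda_min_def using eigenvalues_eigenbasis[OF E sym] fin \<open>E \<noteq> {}\<close>
    by (intro Min_in) auto
  then obtain u where u: "u \<in> E" "lambda_min X = u \<bullet> (X *v u)"
    using eigenvalues_eigenbasis[OF E sym] by auto
  have "u \<noteq> 0" using eigenbasisD(2)[OF E u(1)] by auto
  then show "0 < lambda_min X" using X u by (simp add: pos_def_def)
  show "lambda_min X \<le> lambda_max X"
    using eigenbasis_lambda_bounds(2)[OF E sym u(1)] u(2) by simp
qed

text \<open>On the eigenvector with eigenvalue \<open>r\<close> the step acts as multiplication by
  \<open>1 - 2 r / (lambda_max X + lambda_min X)\<close>. This step size is the one that balances the two extreme
  eigenvalues: it maps them to values of opposite sign and equal modulus
  \<open>(lambda_max X - lambda_min X) / (lambda_max X + lambda_min X)\<close>, and all others lie in between.\<close>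

lemma gradient_step_contraction:
  fixes X :: "real^'n^'n"
  assumes X: "pos_def X"
  shows "norm (v - (2 / (lambda_max X + lambda_min X)) *\<^sub>R (X *v v))
           \<le> (cond_number X - 1) / (cond_number X + 1) * norm v"
proof -
  have sym: "transpose X = X" using X by (simp add: pos_def_def)
  obtain E where E: "eigenbasis X E" by (rule spectral_theorem[OF sym])
  define a where "a = lambda_min X"
  define c where "c = lambda_max X"
  have ac: "0 < a" "a \<le> c" using pos_def_lambda_bounds[OF X] by (auto simp: a_def c_def)
  define q where "q = (c - a) / (c + a)"
  have q: "(cond_number X - 1) / (cond_number X + 1) = q"
    using ac by (simp add: cond_number_def q_def a_def[symmetric] c_def[symmetric] divide_simps)
  have q0: "0 \<le> q" using ac by (simp add: q_def)
  let ?w = "v - (2 / (c + a)) *\<^sub>R (X *v v)"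
  have "(norm ?w)\<^sup>2 = (\<Sum>u\<in>E. (u \<bullet> ?w)\<^sup>2)"
    by (simp only: power2_norm_eq_inner eigenbasis_parseval[OF E, of ?w ?w]) (simp add: power2_eq_square)
  also have "\<dots> \<le> (\<Sum>u\<in>E. q\<^sup>2 * (u \<bullet> v)\<^sup>2)"
  proof (rule sum_mono)
    fix u assume u: "u \<in> E"
    define r where "r = u \<bullet> (X *v u)"
    have r: "a \<le> r" "r \<le> c"
      using eigenbasis_lambda_bounds[OF E sym u] by (auto simp: a_def c_def r_def)
    have "1 - 2 / (c + a) * r = (c + a - 2 * r) / (c + a)"
      using ac by (simp add: diff_divide_distrib)
    moreover have "\<bar>c + a - 2 * r\<bar> \<le> c - a"
      using r by linarith
    ultimately have "\<bar>1 - 2 / (c + a) * r\<bar> \<le> q"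
      using ac by (simp add: q_def abs_divide divide_right_mono)
    then have "(1 - 2 / (c + a) * r)\<^sup>2 \<le> q\<^sup>2"
      using q0 abs_le_square_iff by fastforce
    moreover have "u \<bullet> ?w = (1 - 2 / (c + a) * r) * (u \<bullet> v)"
      by (simp add: inner_simps eigenbasis_coordinate[OF E sym u, of v] r_def algebra_simps)
    ultimately show "(u \<bullet> ?w)\<^sup>2 \<le> q\<^sup>2 * (u \<bullet> v)\<^sup>2"
      by (simp add: power_mult_distrib mult_right_mono)
  qed
  also have "\<dots> = (q * norm v)\<^sup>2"
    by (simp only: power_mult_distrib power2_norm_eq_inner eigenbasis_parseval[OF E, of v v]
        sum_distrib_left) (simp only: power2_eq_square)
  finally have "norm ?w \<le> q * norm v"
    using q0 by (auto intro: power2_le_imp_le)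
  then show ?thesis
    by (simp add: q a_def[symmetric] c_def[symmetric])
qed

section \<open>Square roots and weighted norms\<close>

text \<open>Existence: take square roots of the eigenvalues in an orthonormal eigenbasis. Uniqueness: if \<open>T\<close> is
  another positive definite square root and \<open>X u = r\<^sup>2 u\<close> with \<open>r > 0\<close>, then \<open>w = T u - r u\<close> satisfies
  \<open>T w = - r w\<close>, and positive definiteness of \<open>T\<close> forces \<open>w = 0\<close>. So \<open>T\<close> agrees with the constructed
  root on the eigenbasis.\<close>

lemma pos_def_matrix_sqrt:
  fixes X :: "real^'n^'n"
  assumes X: "pos_def X"
  shows "pos_def (matrix_sqrt X) \<and> matrix_sqrt X ** matrix_sqrt X = X"
proof -
  have sym: "transpose X = X" using X by (simp add: pos_def_def)
  obtain E where E: "eigenbasis X E" by (rule spectral_theorem[OF sym])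
  define r where "r u = sqrt (u \<bullet> (X *v u))" for u
  have r: "r u > 0" "r u * r u = u \<bullet> (X *v u)" if "u \<in> E" for u
  proof -
    have "u \<noteq> 0" using eigenbasisD(2)[OF E that] by auto
    then have "u \<bullet> (X *v u) > 0" using X by (simp add: pos_def_def)
    then show "r u > 0" "r u * r u = u \<bullet> (X *v u)" by (simp_all add: r_def)
  qed
  define F where "F v = (\<Sum>u\<in>E. (r u * (u \<bullet> v)) *\<^sub>R u)" for v
  have linF: "linear F"
    by (rule linearI)
      (simp_all add: F_def inner_simps sum.distrib scaleR_sum_right algebra_simps)
  define Y where "Y = matrix F"
  have Y: "Y *v v = F v" for v
    using matrix_works[OF linF[unfolded linear_matrix_vector_mul_eq[symmetric]]] linF
    by (simp add: Y_def)
  have coord: "u \<bullet> (Y *v v) = r u * (u \<bullet> v)" if "u \<in> E" for u v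
  proof -
    have "u \<bullet> (Y *v v) = (\<Sum>w\<in>E. (r w * (w \<bullet> v)) * (if u = w then 1 else 0))"
      unfolding Y F_def inner_sum_right inner_scaleR_right
      by (intro sum.cong refl) (simp add: eigenbasis_orthonormal[OF E that])
    also have "\<dots> = r u * (u \<bullet> v)"
      using that eigenbasisD(1)[OF E] by (simp add: if_distrib cong: if_cong)
    finally show ?thesis .
  qed
  have symY: "transpose Y = Y"
  proof -
    have "v \<bullet> (transpose Y *v w) = v \<bullet> (Y *v w)" for v w
    proof -
      have "v \<bullet> (transpose Y *v w) = (Y *v v) \<bullet> w"
        by (simp add: dot_lmul_matrix inner_commute[of v])  (simp add: inner_commute)
      also have "\<dots> = (\<Sum>u\<in>E. (r u * (u \<bullet> v)) * (u \<bullet> w))"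
        unfolding eigenbasis_parseval[OF E, of "Y *v v"] by (simp add: coord)
      also have "\<dots> = v \<bullet> (Y *v w)"
        unfolding eigenbasis_parseval[OF E, of v] by (simp add: coord algebra_simps)
      finally show ?thesis .
    qed
    then have "transpose Y *v w = Y *v w" for w
      using vector_eq_ldot by blast
    then show ?thesis unfolding matrix_eq by blast
  qed
  have posY: "v \<bullet> (Y *v v) > 0" if "v \<noteq> 0" for v
  proof -
    have eq: "v \<bullet> (Y *v v) = (\<Sum>u\<in>E. r u * (u \<bullet> v)\<^sup>2)"
      unfolding eigenbasis_parseval[OF E, of v] by (simp add: coord power2_eq_square algebra_simps)
    have "\<exists>u\<in>E. u \<bullet> v \<noteq> 0"
    proof (rule ccontr)
      assume "\<not> ?thesis"
      then have "v \<bullet> v = 0"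
        unfolding eigenbasis_parseval[OF E, of v v] by simp
      then show False using that by simp
    qed
    then obtain u where "u \<in> E" "u \<bullet> v \<noteq> 0" by blast
    then show ?thesis
      unfolding eq using r(1) eigenbasisD(1)[OF E]
      by (intro sum_pos2[of E u]) (auto simp: less_imp_le)
  qed
  have YY: "Y ** Y = X"
  proof -
    have "v \<bullet> (Y *v (Y *v w)) = v \<bullet> (X *v w)" for v w
      unfolding eigenbasis_parseval[OF E, of v]
    proof (intro sum.cong refl)
      fix u assume u: "u \<in> E"
      have "u \<bullet> (Y *v (Y *v w)) = (r u * r u) * (u \<bullet> w)"
        by (simp only: coord[OF u] mult.assoc)
      then show "(u \<bullet> v) * (u \<bullet> (Y *v (Y *v w))) = (u \<bullet> v) * (u \<bullet> (X *v w))"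
        by (simp only: r(2)[OF u] eigenbasis_coordinate[OF E sym u, of w])
    qed
    then have "Y *v (Y *v w) = X *v w" for w
      using vector_eq_ldot by blast
    then show ?thesis by (simp add: matrix_eq matrix_vector_mul_assoc[symmetric])
  qed
  show ?thesis
    unfolding matrix_sqrt_def
  proof (rule theI)
    show "pos_def Y \<and> Y ** Y = X"
      using symY posY YY by (simp add: pos_def_def)
  next
    fix T assume T: "pos_def T \<and> T ** T = X"
    have "T *v u = r u *\<^sub>R u" if "u \<in> E" for u
    proof -
      define w where "w = T *v u - r u *\<^sub>R u"
      have "T *v (T *v u) = (r u * r u) *\<^sub>R u"
        using T eigenbasisD(3)[OF E that] r(2)[OF that] by (simp add: matrix_vector_mul_assoc)
      then have "T *v w = - r u *\<^sub>R w"
        by (simp add: w_def matrix_vector_mult_diff_distrib matrix_vector_mult_scaleR algebra_simps)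
      then have "w \<bullet> (T *v w) = - (r u * (w \<bullet> w))" by simp
      also have "\<dots> \<le> 0" using r(1)[OF that] by (simp add: less_imp_le)
      finally have "w = 0" using T by (force simp: pos_def_def)
      then show ?thesis by (simp add: w_def)
    qed
    then have Tu: "u \<bullet> (T *v v) = r u * (u \<bullet> v)" if "u \<in> E" for u v
      using that T symmetric_inner[of T u v] by (simp add: pos_def_def)
    have "v \<bullet> (T *v w) = v \<bullet> (Y *v w)" for v w
      unfolding eigenbasis_parseval[OF E, of v] by (simp add: coord Tu)
    then have "T *v w = Y *v w" for w
      using vector_eq_ldot by blast
    then show "T = Y" by (simp add: matrix_eq)
  qed
qed

lemma pos_def_nonneg:
  assumes "pos_def X"
  shows "0 \<le> v \<bullet> (X *v v)"
  using assms by (cases "v = 0") (simp_all add: pos_def_def less_imp_le)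

lemma pos_def_invertible:
  fixes X :: "real^'n^'n"
  assumes "pos_def X"
  shows "invertible X"
proof -
  have "X *v v = 0 \<Longrightarrow> v = 0" for v
    using assms by (force simp: pos_def_def)
  then show ?thesis
    by (simp add: invertible_left_inverse matrix_left_invertible_ker)
qed

lemma pos_def_matrix_inv:
  fixes X :: "real^'n^'n"
  assumes "pos_def X"
  shows "matrix_inv X *v (X *v v) = v" "X *v (matrix_inv X *v v) = v"
proof -
  have "X ** matrix_inv X = mat 1 \<and> matrix_inv X ** X = mat 1"
    using pos_def_invertible[OF assms] unfolding invertible_def matrix_inv_def by (rule someI_ex)
  then show "matrix_inv X *v (X *v v) = v" "X *v (matrix_inv X *v v) = v"
    by (simp_all add: matrix_vector_mul_assoc)
qed

lemma wnorm_power2: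
  assumes "pos_def X"
  shows "(wnorm X v)\<^sup>2 = v \<bullet> (X *v v)"
  using pos_def_nonneg[OF assms] by (simp add: wnorm_def)

text \<open>The square root is an isometry from the weighted norm to the Euclidean one, so inequalities in weighted
  norms reduce to Euclidean ones.\<close>

lemma wnorm_eq_norm_sqrt:
  assumes "pos_def X"
  shows "wnorm X v = norm (matrix_sqrt X *v v)"
proof -
  let ?Y = "matrix_sqrt X"
  note Y = pos_def_matrix_sqrt[OF assms]
  have "v \<bullet> (X *v v) = v \<bullet> (?Y *v (?Y *v v))"
    using Y by (simp add: matrix_vector_mul_assoc)
  also have "\<dots> = (?Y *v v) \<bullet> (?Y *v v)"
    using Y by (intro symmetric_inner) (simp add: pos_def_def)
  finally show ?thesis by (simp add: wnorm_def norm_eq_sqrt_inner)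
qed

lemma wnorm_matrix_inv_eq_norm:
  assumes "pos_def X"
  shows "wnorm (matrix_inv X) g = norm (matrix_inv (matrix_sqrt X) *v g)"
proof -
  define h where "h = matrix_inv X *v g"
  let ?Y = "matrix_sqrt X"
  note Y = pos_def_matrix_sqrt[OF assms]
  have g: "g = X *v h" by (simp add: h_def pos_def_matrix_inv[OF assms])
  then have "g = ?Y *v (?Y *v h)"
    using Y by (simp add: matrix_vector_mul_assoc)
  then have "matrix_inv ?Y *v g = ?Y *v h"
    using Y by (simp add: pos_def_matrix_inv(1))
  moreover have "wnorm (matrix_inv X) g = wnorm X h"
    unfolding wnorm_def h_def[symmetric] by (simp add: g inner_commute)
  ultimately show ?thesis
    by (simp add: wnorm_eq_norm_sqrt[OF assms])
qed

lemma norm_le_wnorm: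
  assumes "pos_def X"
  shows "norm v \<le> norm2 (matrix_inv (matrix_sqrt X)) * wnorm X v"
proof -
  let ?Y = "matrix_sqrt X"
  have "norm v = norm (matrix_inv ?Y *v (?Y *v v))"
    using pos_def_matrix_sqrt[OF assms] by (simp add: pos_def_matrix_inv(1))
  also have "\<dots> \<le> norm2 (matrix_inv ?Y) * norm (?Y *v v)"
    unfolding norm2_def by (rule onorm) simp
  finally show ?thesis by (simp add: wnorm_eq_norm_sqrt[OF assms])
qed

text \<open>The Cauchy-Schwarz inequality for \<open>g\<close> and \<open>v\<close> after moving one square root from \<open>v\<close> to \<open>g\<close>.\<close>

lemma inner_le_wnorm_dual:
  assumes "pos_def X"
  shows "g \<bullet> v \<le> wnorm (matrix_inv X) g * wnorm X v"
proof -
  let ?Y = "matrix_sqrt X"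
  note Y = pos_def_matrix_sqrt[OF assms]
  have "g \<bullet> v = (?Y *v (matrix_inv ?Y *v g)) \<bullet> v"
    using Y by (simp add: pos_def_matrix_inv(2))
  also have "\<dots> = (matrix_inv ?Y *v g) \<bullet> (?Y *v v)"
    using Y symmetric_inner[of ?Y "matrix_inv ?Y *v g" v] by (simp add: pos_def_def)
  also have "\<dots> \<le> norm (matrix_inv ?Y *v g) * norm (?Y *v v)"
    by (rule norm_cauchy_schwarz)
  finally show ?thesis
    by (simp add: wnorm_eq_norm_sqrt[OF assms] wnorm_matrix_inv_eq_norm[OF assms])
qed

section \<open>Projected gradient steps for a strictly convex quadratic\<close>

definition contraction_factor :: "real^'n^'n \<Rightarrow> real" where
  "contraction_factor X = (cond_number X - 1) / (cond_number X + 1)"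

lemma contraction_factor_bounds:
  assumes "pos_def X"
  shows "0 \<le> contraction_factor X" "contraction_factor X < 1"
proof -
  have "1 \<le> cond_number X"
    using pos_def_lambda_bounds[OF assms] by (simp add: cond_number_def)
  then show "0 \<le> contraction_factor X" "contraction_factor X < 1"
    by (simp_all add: contraction_factor_def)
qed

text \<open>One projected gradient step for the objective \<open>w \<bullet> (X *v w) + 2 * (w \<bullet> g) + c\<close> over \<open>Z\<close>. The factor
  \<open>2\<close> is that of the gradient \<open>2 (X *v w + g)\<close>; the step size proper is
  \<open>1 / (lambda_max X + lambda_min X)\<close>.\<close>

definition qp_step :: "real^'n^'n \<Rightarrow> (real^'n) set \<Rightarrow> real^'n \<Rightarrow> real^'n \<Rightarrow> real^'n" where
  "qp_step X Z g z = closest_point Z (z - (2 / (lambda_max X + lambda_min X)) *\<^sub>R (X *v z + g))"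

text \<open>The projection is nonexpansive, and the linear term cancels in the difference of two gradient
  steps.\<close>

lemma qp_step_contraction:
  assumes "pos_def X" "closed Z" "convex Z" "Z \<noteq> {}"
  shows "norm (qp_step X Z g z - qp_step X Z g w) \<le> contraction_factor X * norm (z - w)"
proof -
  let ?t = "2 / (lambda_max X + lambda_min X)"
  have "norm (qp_step X Z g z - qp_step X Z g w)
      \<le> norm ((z - ?t *\<^sub>R (X *v z + g)) - (w - ?t *\<^sub>R (X *v w + g)))"
    unfolding qp_step_def dist_norm[symmetric] using assms by (intro closest_point_lipschitz)
  also have "(z - ?t *\<^sub>R (X *v z + g)) - (w - ?t *\<^sub>R (X *v w + g))
      = (z - w) - ?t *\<^sub>R (X *v (z - w))"
    by (simp add: matrix_vector_mult_diff_distrib algebra_simps)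
  also have "norm \<dots> \<le> contraction_factor X * norm (z - w)"
    unfolding contraction_factor_def by (rule gradient_step_contraction[OF assms(1)])
  finally show ?thesis .
qed

lemma qp_step_in_set:
  assumes "closed Z" "Z \<noteq> {}"
  shows "qp_step X Z g z \<in> Z"
  unfolding qp_step_def using assms by (rule closest_point_in_set)

lemma qp_step_funpow_contraction:
  assumes "pos_def X" "closed Z" "convex Z" "Z \<noteq> {}" "qp_step X Z g s = s"
  shows "norm ((qp_step X Z g ^^ l) z - s) \<le> contraction_factor X ^ l * norm (z - s)"
proof (induction l)
  case (Suc l)
  have "norm ((qp_step X Z g ^^ Suc l) z - s)
      = norm (qp_step X Z g ((qp_step X Z g ^^ l) z) - qp_step X Z g s)"
    by (simp add: assms(5))
  also have "\<dots> \<le> contraction_factor X * norm ((qp_step X Z g ^^ l) z - s)"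
    by (rule qp_step_contraction[OF assms(1-4)])
  also have "\<dots> \<le> contraction_factor X * (contraction_factor X ^ l * norm (z - s))"
    using Suc contraction_factor_bounds[OF assms(1)] by (intro mult_left_mono)
  finally show ?case by (simp add: mult.assoc)
qed simp

text \<open>Banach's fixed point theorem yields the optimizer without any coercivity argument. The obtuse angle
  criterion for the projection turns the fixed point equation into the variational inequality, which
  is the first-order optimality condition of the constrained problem.\<close>

lemma qp_step_fixed_point:
  assumes "pos_def X" "closed Z" "convex Z" "Z \<noteq> {}"
  obtains s where "s \<in> Z" "qp_step X Z g s = s" "\<And>w. w \<in> Z \<Longrightarrow> 0 \<le> (X *v s + g) \<bullet> (w - s)"
proof -
  have "\<exists>!s\<in>Z. qp_step X Z g s = s"
  proof (rule Banach_fix[where c = "contraction_factor X"])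
    show "complete Z" using assms(2) by (simp add: complete_eq_closed)
    show "qp_step X Z g ` Z \<subseteq> Z" using qp_step_in_set[OF assms(2,4)] by blast
    show "dist (qp_step X Z g z) (qp_step X Z g w) \<le> contraction_factor X * dist z w" for z w
      unfolding dist_norm by (rule qp_step_contraction[OF assms])
  qed (use assms contraction_factor_bounds in auto)
  then obtain s where s: "s \<in> Z" "qp_step X Z g s = s" by blast
  define t where "t = 2 / (lambda_max X + lambda_min X)"
  have t: "t > 0" using pos_def_lambda_bounds[OF assms(1)] by (simp add: t_def)
  have "0 \<le> (X *v s + g) \<bullet> (w - s)" if "w \<in> Z" for w
  proof -
    have "closest_point Z (s - t *\<^sub>R (X *v s + g)) = s"
      using s(2) by (simp add: qp_step_def t_def)
    then have "(s - t *\<^sub>R (X *v s + g) - s) \<bullet> (w - s) \<le> 0"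
      using closest_point_dot[OF assms(3,2) that] by metis
    then have "0 \<le> t * ((X *v s + g) \<bullet> (w - s))" by simp
    then show ?thesis using t by (simp add: zero_le_mult_iff)
  qed
  with s show ?thesis using that by blast
qed

lemma quadratic_expansion:
  fixes X :: "real^'n^'n"
  assumes "transpose X = X"
  shows "w \<bullet> (X *v w) + 2 * (w \<bullet> g) = s \<bullet> (X *v s) + 2 * (s \<bullet> g)
    + 2 * ((X *v s + g) \<bullet> (w - s)) + (w - s) \<bullet> (X *v (w - s))"
  using symmetric_inner[OF assms, of s w]
  by (simp add: matrix_vector_mult_diff_distrib inner_simps inner_commute algebra_simps)

text \<open>By the exact second-order expansion around \<open>s\<close>, the objective grows by a nonnegative first-order
  term and a positive quadratic term, so a solution of the variational inequality is the unique
  minimizer.\<close>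

lemma minimizer_eqI:
  fixes X :: "real^'n^'n"
  assumes X: "pos_def X" and f: "\<And>w. f w x = w \<bullet> (X *v w) + 2 * (w \<bullet> g) + c"
    and s: "s \<in> Z" and vi: "\<And>w. w \<in> Z \<Longrightarrow> 0 \<le> (X *v s + g) \<bullet> (w - s)"
  shows "minimizer f Z x = s"
proof -
  have less: "f s x < f w x" if "w \<in> Z" "w \<noteq> s" for w
  proof -
    have "(w - s) \<bullet> (X *v (w - s)) > 0"
      using X that by (simp add: pos_def_def)
    then show ?thesis
      using vi[OF that(1)] quadratic_expansion[of X w g s] X by (simp add: f pos_def_def)
  qed
  show ?thesis
    unfolding minimizer_def is_arg_min_def
  proof (rule the_equality)
    show "s \<in> Z \<and> (\<nexists>y. y \<in> Z \<and> f y x < f s x)"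
      using s less by (metis less_irrefl less_trans)
    show "z = s" if "z \<in> Z \<and> (\<nexists>y. y \<in> Z \<and> f y x < f z x)" for z
      using that s less by blast
  qed
qed

text \<open>Testing each variational inequality with the solution of the other one and adding gives
  \<open>(wnorm X (s - t))\<^sup>2 \<le> (h - g) \<bullet> (s - t)\<close>; the dual norm inequality then cancels one factor. In
  these norms the solution map is Lipschitz with constant \<open>1\<close>.\<close>

lemma solution_lipschitz:
  fixes X :: "real^'n^'n"
  assumes X: "pos_def X"
    and s: "s \<in> Z" "\<And>w. w \<in> Z \<Longrightarrow> 0 \<le> (X *v s + g) \<bullet> (w - s)"
    and t: "t \<in> Z" "\<And>w. w \<in> Z \<Longrightarrow> 0 \<le> (X *v t + h) \<bullet> (w - t)"
  shows "wnorm X (s - t) \<le> wnorm (matrix_inv X) (h - g)"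
proof -
  have "0 \<le> (X *v s + g) \<bullet> (t - s) + (X *v t + h) \<bullet> (s - t)"
    using s(2)[OF t(1)] t(2)[OF s(1)] by simp
  also have "\<dots> = (h - g) \<bullet> (s - t) - (s - t) \<bullet> (X *v (s - t))"
    by (simp add: matrix_vector_mult_diff_distrib inner_simps inner_commute algebra_simps)
  finally have "(wnorm X (s - t))\<^sup>2 \<le> (h - g) \<bullet> (s - t)"
    by (simp add: wnorm_power2[OF X])
  also have "\<dots> \<le> wnorm (matrix_inv X) (h - g) * wnorm X (s - t)"
    by (rule inner_le_wnorm_dual[OF X])
  finally have "wnorm X (s - t) * wnorm X (s - t) \<le> wnorm (matrix_inv X) (h - g) * wnorm X (s - t)"
    by (simp add: power2_eq_square)
  moreover have "wnorm X (s - t) \<ge> 0" "wnorm (matrix_inv X) (h - g) \<ge> 0"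
    by (simp_all add: wnorm_eq_norm_sqrt[OF X] wnorm_matrix_inv_eq_norm[OF X])
  ultimately show ?thesis
    by (cases "wnorm X (s - t) = 0") (auto simp: mult_le_cancel_right)
qed

lemma gradient_quadratic:
  fixes X :: "real^'n^'n"
  assumes "transpose X = X"
  shows "gradient (\<lambda>w. w \<bullet> (X *v w) + 2 * (w \<bullet> g) + c) z = 2 *\<^sub>R (X *v z + g)"
  unfolding gradient_def
proof (rule the_equality)
  have lin: "((*v) X has_derivative (*v) X) (at z)"
    by (rule bounded_linear_imp_has_derivative) simp
  have "((\<lambda>w. w \<bullet> (X *v w) + 2 * (w \<bullet> g) + c) has_derivative
      (\<lambda>h. z \<bullet> (X *v h) + h \<bullet> (X *v z) + 2 * (h \<bullet> g))) (at z)"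
    by (auto intro!: derivative_eq_intros lin)
  moreover have "z \<bullet> (X *v h) + h \<bullet> (X *v z) + 2 * (h \<bullet> g) = h \<bullet> (2 *\<^sub>R (X *v z + g))" for h
    using symmetric_inner[OF assms, of z h] by (simp add: inner_simps inner_commute)
  ultimately show *: "GDERIV (\<lambda>w. w \<bullet> (X *v w) + 2 * (w \<bullet> g) + c) z :> 2 *\<^sub>R (X *v z + g)"
    by (simp add: gderiv_def)
  fix D assume "GDERIV (\<lambda>w. w \<bullet> (X *v w) + 2 * (w \<bullet> g) + c) z :> D"
  with * have "(\<lambda>h. h \<bullet> (2 *\<^sub>R (X *v z + g))) = (\<lambda>h. h \<bullet> D)"
    unfolding gderiv_def by (rule has_derivative_unique)
  then have "h \<bullet> (2 *\<^sub>R (X *v z + g)) = h \<bullet> D" for h by (rule fun_cong)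
  then show "D = 2 *\<^sub>R (X *v z + g)"
    using vector_eq_ldot by metis
qed

section \<open>Driven linear contractions\<close>

text \<open>Writing the input coefficient as \<open>1 - q\<close> makes each step a convex combination, so that a level \<open>L\<close>
  of the input is also the level to which \<open>e\<close> is attracted. Starting at index \<open>n\<close> lets the same bound
  serve both the global estimate (\<open>n = 0\<close>) and the asymptotic one (\<open>n\<close> large).\<close>

lemma contraction_recursion:
  fixes e :: "nat \<Rightarrow> real"
  assumes q: "0 \<le> q" and rec: "\<And>k. e (Suc k) \<le> q * e k + (1 - q) * u k" and "q \<le> 1"
    and L: "\<And>k. n \<le> k \<Longrightarrow> u k \<le> L"
  shows "e (n + j) \<le> L + q ^ j * (e n - L)"
proof (induction j)
  case (Suc j)
  have "e (n + Suc j) \<le> q * e (n + j) + (1 - q) * u (n + j)"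
    using rec by simp
  also have "\<dots> \<le> q * (L + q ^ j * (e n - L)) + (1 - q) * L"
    using Suc q \<open>q \<le> 1\<close> L by (intro add_mono mult_left_mono) auto
  finally show ?case by (simp add: algebra_simps)
qed simp

text \<open>Any real level above the limit superior of the input eventually dominates it, and from then on
  \<open>e\<close> decays geometrically towards that level. The bound is one of extended reals, which covers
  unbounded inputs.\<close>

lemma limsup_contraction_recursion:
  fixes e :: "nat \<Rightarrow> real"
  assumes q: "0 \<le> q" "q < 1" and rec: "\<And>k. e (Suc k) \<le> q * e k + (1 - q) * u k"
  shows "limsup (\<lambda>k. ereal (e k)) \<le> limsup (\<lambda>k. ereal (u k))"
  unfolding Limsup_le_iff
proof (intro allI impI)
  fix y assume "limsup (\<lambda>k. ereal (u k)) < y"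
  then obtain L where L: "limsup (\<lambda>k. ereal (u k)) < ereal L" "ereal L < y"
    using ereal_dense2 by blast
  have "eventually (\<lambda>k. ereal (u k) < ereal L) sequentially"
    using L(1) Limsup_le_iff[of sequentially "\<lambda>k. ereal (u k)"] by blast
  then obtain n where n: "\<And>k. n \<le> k \<Longrightarrow> u k \<le> L"
    unfolding eventually_sequentially less_ereal.simps by (meson less_imp_le)
  have "(\<lambda>j. L + q ^ j * (e n - L)) \<longlonglongrightarrow> L + 0 * (e n - L)"
    using q by (intro tendsto_intros LIMSEQ_power_zero) auto
  then have "(\<lambda>j. ereal (L + q ^ j * (e n - L))) \<longlonglongrightarrow> ereal L"
    by (intro tendsto_ereal) simp
  then have "eventually (\<lambda>j. ereal (L + q ^ j * (e n - L)) < y) sequentially"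
    using L(2) by (rule order_tendstoD)
  then have "eventually (\<lambda>j. ereal (e (j + n)) < y) sequentially"
  proof eventually_elim
    case (elim j)
    have "e (j + n) \<le> L + q ^ j * (e n - L)"
      using contraction_recursion[where e = e and u = u and n = n and j = j, OF q(1) rec less_imp_le[OF q(2)] n] by (simp add: add.commute)
    then have "ereal (e (j + n)) \<le> ereal (L + q ^ j * (e n - L))" by simp
    then show ?case using elim by (rule le_less_trans)
  qed
  then show "eventually (\<lambda>k. ereal (e k) < y) sequentially"
    by (simp only: eventually_sequentially_seg[of "\<lambda>k. ereal (e k) < y"])
qed

text \<open>The natural comparison functions would be \<open>q ^ k * s\<close> and \<open>C / (1 - q) * s\<close>, but these fail to be
  strictly increasing in \<open>s\<close> when \<open>q = 0\<close> and \<open>k > 0\<close>, or when \<open>C = 0\<close>. Hence the rate is raised to at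
  least \<open>1 / 2\<close> and the gain is increased by \<open>1\<close>.\<close>

lemma input_to_state_stableI:
  assumes q: "0 \<le> q" "q < 1" and C: "0 \<le> C"
    and rec: "\<And>e d k. (e, d) \<in> T \<Longrightarrow> norm (e (Suc k)) \<le> q * norm (e k) + C * norm (d k)"
  shows "input_to_state_stable T"
proof -
  define c where "c = max q (1 / 2)"
  have c: "0 < c" "c < 1" "q \<le> c" using q by (auto simp: c_def)
  define a where "a = C / (1 - c)"
  have a: "0 \<le> a" "(1 - c) * a = C" using c C by (auto simp: a_def)
  define \<beta> :: "real \<Rightarrow> nat \<Rightarrow> real" where "\<beta> s k = c ^ k * s" for s k
  define \<gamma> :: "real \<Rightarrow> real" where "\<gamma> s = (a + 1) * s" for s
  have "class_KL \<beta>"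
    unfolding class_KL_def class_K_def
  proof (intro conjI allI impI)
    show "continuous_on {0..} (\<lambda>s. \<beta> s k)" "strict_mono_on {0..} (\<lambda>s. \<beta> s k)" "\<beta> 0 k = 0" for k
      using c by (auto simp: \<beta>_def strict_mono_on_def intro!: continuous_intros)
    show "decseq (\<beta> s)" if "0 \<le> s" for s
      unfolding decseq_def \<beta>_def using c that by (auto intro!: mult_right_mono power_decreasing)
    have "(\<lambda>k. c ^ k * s) \<longlonglongrightarrow> 0 * s" for s
      using c by (intro tendsto_intros LIMSEQ_power_zero) auto
    then show "\<beta> s \<longlonglongrightarrow> 0" for s by (simp add: \<beta>_def[abs_def])
  qed
  moreover have "class_K \<gamma>"
    using a by (auto simp: class_K_def \<gamma>_def strict_mono_on_def intro!: continuous_intros)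
  moreover have "norm (e k) \<le> \<beta> (norm (e 0)) k + \<gamma> (SUP j. norm (d j))"
    if T: "(e, d) \<in> T" and d: "bounded (range d)" for e d k
  proof -
    define D where "D = (SUP j. norm (d j))"
    have "bdd_above (range (\<lambda>j. norm (d j)))"
      using d by (auto simp: bounded_iff bdd_above_def)
    then have D: "norm (d j) \<le> D" for j
      unfolding D_def by (rule cSUP_upper[OF UNIV_I])
    have D0: "0 \<le> D" using D[of 0] norm_ge_zero[of "d 0"] by linarith
    have "norm (e (Suc k)) \<le> c * norm (e k) + (1 - c) * (a * norm (d k))" for k
    proof -
      have "q * norm (e k) \<le> c * norm (e k)"
        using c by (intro mult_right_mono) auto
      moreover have "(1 - c) * (a * norm (d k)) = C * norm (d k)"
        by (simp only: mult.assoc[symmetric] a(2))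
      ultimately show ?thesis using rec[OF T, of k] by linarith
    qed
    from contraction_recursion[of c "\<lambda>k. norm (e k)" "\<lambda>k. a * norm (d k)" 0 "a * D" k, OF _ this]
    have "norm (e k) \<le> a * D + c ^ k * (norm (e 0) - a * D)"
      using c a D by (simp add: mult_left_mono)
    also have "\<dots> \<le> c ^ k * norm (e 0) + (a + 1) * D"
      using c a D0 by (simp add: algebra_simps)
    finally show ?thesis by (simp add: \<beta>_def \<gamma>_def D_def)
  qed
  ultimately show ?thesis
    unfolding input_to_state_stable_def by (intro exI[of _ \<beta>] exI[of _ \<gamma>]) auto
qed

section \<open>The condensed problem as a strictly convex quadratic\<close>

definition block :: "'i \<Rightarrow> real^('i::finite \<times> 'n::finite) \<Rightarrow> real^'n" where
  "block i v = (\<chi> c. v $ (i, c))"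

text \<open>Both the weight of the stacked states and that of the stacked inputs have this form, with blocks
  indexed by the stages.\<close>

definition block_diag :: "('i::finite \<Rightarrow> real^'n^'n) \<Rightarrow> real^('i \<times> 'n)^('i \<times> 'n)" where
  "block_diag D = (\<chi> p q. if fst p = fst q then D (fst p) $ snd p $ snd q else 0)"

lemma H_hat_eq_block_diag: "H_hat Q P = block_diag (\<lambda>i. if i = None then P else Q)"
  by (simp add: H_hat_def block_diag_def)

lemma kronecker_one_eq_block_diag: "kronecker (mat 1) R = block_diag (\<lambda>_. R)"
  by (simp add: kronecker_def block_diag_def mat_def vec_eq_iff)

lemma linear_block: "linear (block i :: real^('i::finite \<times> 'n::finite) \<Rightarrow> real^'n)"
  by (rule linearI) (simp_all add: block_def vec_eq_iff)

lemma inner_eq_sum_block: "v \<bullet> w = (\<Sum>i\<in>UNIV. block i v \<bullet> block i w)"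
proof -
  have "v \<bullet> w = (\<Sum>p\<in>UNIV \<times> UNIV. v $ p * w $ p)"
    by (simp add: inner_vec_def)
  also have "\<dots> = (\<Sum>i\<in>UNIV. \<Sum>c\<in>UNIV. v $ (i, c) * w $ (i, c))"
    by (simp add: sum.cartesian_product case_prod_unfold)
  finally show ?thesis by (simp add: inner_vec_def block_def)
qed

lemma block_diag_mult: "block i (block_diag D *v v) = D i *v block i v"
proof -
  have "(block_diag D *v v) $ (i, c) = (D i *v block i v) $ c" for c
  proof -
    have "(block_diag D *v v) $ (i, c)
        = (\<Sum>p\<in>UNIV \<times> UNIV. (if i = fst p then D i $ c $ snd p else 0) * v $ p)"
      by (simp add: matrix_vector_mult_def block_diag_def cong: if_cong)
    also have "\<dots> = (\<Sum>j\<in>UNIV. \<Sum>d\<in>UNIV. (if i = j then D i $ c $ d else 0) * v $ (j, d))"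
      by (simp add: sum.cartesian_product case_prod_unfold)
    also have "\<dots> = (\<Sum>j\<in>UNIV. if i = j then \<Sum>d\<in>UNIV. D i $ c $ d * v $ (j, d) else 0)"
      by (intro sum.cong) auto
    finally show ?thesis by (simp add: matrix_vector_mult_def block_def)
  qed
  then show ?thesis by (simp add: block_def vec_eq_iff)
qed

lemma pos_def_block_diag:
  fixes D :: "'i::finite \<Rightarrow> real^'n^'n"
  assumes D: "\<And>i. pos_def (D i)"
  shows "pos_def (block_diag D)"
proof -
  have "D i $ c $ d = D i $ d $ c" for i c d
  proof -
    have "transpose (D i) $ d $ c = D i $ d $ c" using D by (simp add: pos_def_def)
    then show ?thesis by (simp add: transpose_def)
  qed
  then have "transpose (block_diag D) = block_diag D"
    by (auto simp: transpose_def block_diag_def vec_eq_iff)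
  moreover have "v \<bullet> (block_diag D *v v) > 0" if "v \<noteq> 0" for v
  proof -
    from that obtain p where "v $ p \<noteq> 0" by (auto simp: vec_eq_iff)
    then have "block (fst p) v \<noteq> 0"
      by (auto simp: block_def vec_eq_iff intro!: exI[of _ "snd p"])
    moreover have "0 \<le> block i v \<bullet> (D i *v block i v)" for i
      using D[of i] by (cases "block i v = 0") (auto simp: pos_def_def less_imp_le)
    moreover have "0 < block i v \<bullet> (D i *v block i v)" if "block i v \<noteq> 0" for i
      using D[of i] that by (simp add: pos_def_def)
    ultimately show ?thesis
      unfolding inner_eq_sum_block[of v] block_diag_mult
      by (intro sum_pos2[of UNIV "fst p"]) auto
  qed
  ultimately show ?thesis by (simp add: pos_def_def)
qed

text \<open>The products in the condensed problem all have this shape; as bilinear forms they are evaluations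
  of the state cost at predicted states.\<close>

lemma inner_sandwich:
  fixes S :: "real^'a^'c" and T :: "real^'b^'c"
  shows "v \<bullet> ((transpose S ** W ** T) *v w) = (S *v v) \<bullet> (W *v (T *v w))"
proof -
  have "v \<bullet> ((transpose S ** W ** T) *v w) = v \<bullet> (transpose S *v (W *v (T *v w)))"
    by (simp add: matrix_vector_mul_assoc matrix_mul_assoc)
  also have "\<dots> = (W *v (T *v w)) \<bullet> (S *v v)"
    by (simp add: inner_commute[of v] dot_lmul_matrix)
  finally show ?thesis by (simp add: inner_commute)
qed

lemma pos_def_H_hat: "pos_def Q \<Longrightarrow> pos_def P \<Longrightarrow> pos_def (H_hat Q P)"
  unfolding H_hat_eq_block_diag by (rule pos_def_block_diag) simp

text \<open>The state cost contributes a semidefinite form, since the prediction matrix may have a kernel;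
  definiteness comes from the input cost.\<close>

lemma pos_def_qp_H:
  fixes Q :: "real^'n^'n" and R :: "real^'m^'m"
  assumes "pos_def R" "pos_def Q" "pos_def P"
  shows "pos_def (qp_H A B Q R P :: real^('N::{finite,linorder} \<times> 'm)^('N \<times> 'm))"
proof -
  let ?B = "B_hat A B :: real^('N \<times> 'm)^('N option \<times> 'n)"
  let ?W = "H_hat Q P :: real^('N option \<times> 'n)^('N option \<times> 'n)"
  let ?K = "kronecker (mat 1) R :: real^('N \<times> 'm)^('N \<times> 'm)"
  have W: "pos_def ?W" by (rule pos_def_H_hat[OF assms(2,3)])
  have K: "pos_def ?K"
    unfolding kronecker_one_eq_block_diag by (rule pos_def_block_diag[OF assms(1)])
  have "transpose (transpose ?B ** ?W ** ?B) = transpose ?B ** ?W ** ?B"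
    using W by (simp add: matrix_transpose_mul matrix_mul_assoc pos_def_def)
  moreover have "transpose (X + Y) = transpose X + transpose Y" for X Y :: "real^('N \<times> 'm)^('N \<times> 'm)"
    by (simp add: transpose_def vec_eq_iff)
  ultimately have "transpose (qp_H A B Q R P) = (qp_H A B Q R P :: real^('N \<times> 'm)^('N \<times> 'm))"
    using K by (simp add: qp_H_def pos_def_def)
  moreover have "v \<bullet> (qp_H A B Q R P *v v) > 0" if "v \<noteq> 0" for v :: "real^('N \<times> 'm)"
  proof -
    have "v \<bullet> (?K *v v) > 0" using K that by (simp add: pos_def_def)
    then show ?thesis
      using pos_def_nonneg[OF W, of "?B *v v"]
      by (simp add: qp_H_def matrix_vector_mult_add_rdistrib inner_add_right inner_sandwich)
  qed
  ultimately show ?thesis by (simp add: pos_def_def)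
qed

lemma sum_UNIV_Plus:
  fixes h :: "'a::finite + 'b::finite \<Rightarrow> 'c::comm_monoid_add"
  shows "(\<Sum>p\<in>UNIV. h p) = (\<Sum>a\<in>UNIV. h (Inl a)) + (\<Sum>b\<in>UNIV. h (Inr b))"
  using sum.Plus[of "UNIV :: 'a set" "UNIV :: 'b set" h] by (simp add: UNIV_Plus_UNIV comp_def)

lemma inner_block2:
  "stack v w \<bullet> (block2 X11 X12 X21 X22 *v stack v w)
    = v \<bullet> (X11 *v v) + v \<bullet> (X12 *v w) + (w \<bullet> (X21 *v v) + w \<bullet> (X22 *v w))"
proof -
  have "block2 X11 X12 X21 X22 *v stack v w = stack (X11 *v v + X12 *v w) (X21 *v v + X22 *v w)"
    by (auto simp: vec_eq_iff block2_def stack_def matrix_vector_mult_def sum_UNIV_Plus split: sum.split)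
  moreover have "stack v w \<bullet> stack v' w' = v \<bullet> v' + w \<bullet> w'" for v' w'
    by (simp add: inner_vec_def stack_def sum_UNIV_Plus)
  ultimately show ?thesis by (simp add: inner_add_right)
qed

text \<open>The block matrix of the problem is the form \<open>y \<bullet> (H_hat Q P *v y) + z \<bullet> (kronecker (mat 1) R *v z)\<close>
  at the predicted states \<open>y = B_hat A B *v z + A_hat A *v x\<close>. It is therefore nonnegative, so that
  squaring the weighted norm removes the root.\<close>

lemma cost_eq_quadratic:
  fixes Q :: "real^'n^'n" and R :: "real^'m^'m" and z :: "real^('N::{finite,linorder} \<times> 'm)"
  assumes "pos_def R" "pos_def Q" "pos_def P"
  shows "cost A B Q R P z x
    = z \<bullet> (qp_H A B Q R P *v z) + 2 * (z \<bullet> (qp_G A B Q P *v x)) + x \<bullet> (qp_W TYPE('N) A Q P *v x)"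
proof -
  let ?A = "A_hat A :: real^'n^('N option \<times> 'n)"
  let ?B = "B_hat A B :: real^('N \<times> 'm)^('N option \<times> 'n)"
  let ?W = "H_hat Q P :: real^('N option \<times> 'n)^('N option \<times> 'n)"
  let ?K = "kronecker (mat 1) R :: real^('N \<times> 'm)^('N \<times> 'm)"
  let ?H = "qp_H A B Q R P :: real^('N \<times> 'm)^('N \<times> 'm)"
  let ?G = "qp_G A B Q P :: real^'n^('N \<times> 'm)"
  let ?r = "z \<bullet> (?H *v z) + 2 * (z \<bullet> (?G *v x)) + x \<bullet> (qp_W TYPE('N) A Q P *v x)"
  let ?y = "?B *v z + ?A *v x"
  have W: "pos_def ?W" by (rule pos_def_H_hat[OF assms(2,3)])
  have K: "pos_def ?K"
    unfolding kronecker_one_eq_block_diag by (rule pos_def_block_diag[OF assms(1)])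
  have "x \<bullet> (transpose ?G *v z) = z \<bullet> (?G *v x)"
    by (simp add: inner_commute[of x] dot_lmul_matrix)
  then have M: "stack z x \<bullet> (qp_M A B Q R P *v stack z x) = ?r"
    by (simp add: qp_M_def inner_block2)
  have "(?B *v z) \<bullet> (?W *v (?A *v x)) = (?A *v x) \<bullet> (?W *v (?B *v z))"
    using symmetric_inner[of ?W "?B *v z" "?A *v x"] W by (simp add: pos_def_def inner_commute)
  then have "?r = ?y \<bullet> (?W *v ?y) + z \<bullet> (?K *v z)"
    by (simp add: qp_H_def qp_G_def qp_W_def matrix_vector_mult_add_rdistrib inner_add_right
        inner_add_left matrix_vector_right_distrib inner_sandwich)
  then have "0 \<le> ?r"
    using pos_def_nonneg[OF W] pos_def_nonneg[OF K] by (metis add_nonneg_nonneg)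
  then show ?thesis
    unfolding cost_def wnorm_def M by (rule real_sqrt_pow2)
qed

lemma proj_grad_quadratic:
  fixes X :: "real^'n^'n"
  assumes "transpose X = X"
    and f: "\<And>w. f w x = w \<bullet> (X *v w) + 2 * (w \<bullet> g) + c"
  shows "proj_grad l (1 / (lambda_max X + lambda_min X)) f Z z x = (qp_step X Z g ^^ l) z"
proof -
  have "proj_grad_step (1 / (lambda_max X + lambda_min X)) f Z w x = qp_step X Z g w" for w
    by (simp add: proj_grad_step_def qp_step_def f gradient_quadratic[OF assms(1)])
  then show ?thesis by (simp add: proj_grad_def)
qed

text \<open>The constraint set is an intersection of preimages of \<open>U\<close> under the linear block maps.\<close>

lemma input_sequences_closed_convex:
  fixes U :: "(real^'m) set"
  assumes "closed U" "convex U" "0 \<in> U"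
  shows "closed (input_sequences U :: (real^('N::finite \<times> 'm)) set)"
    "convex (input_sequences U :: (real^('N::finite \<times> 'm)) set)"
    "input_sequences U \<noteq> ({} :: (real^('N::finite \<times> 'm)) set)"
proof -
  have eq: "(input_sequences U :: (real^('N \<times> 'm)) set) = (\<Inter>i. block i -` U)"
    by (auto simp: input_sequences_def block_def)
  show "closed (input_sequences U :: (real^('N \<times> 'm)) set)"
    unfolding eq by (intro closed_INT ballI closed_vimage assms(1) linear_continuous_on
        linear_conv_bounded_linear[THEN iffD1] linear_block)
  show "convex (input_sequences U :: (real^('N \<times> 'm)) set)"
    unfolding eq by (intro convex_INT convex_linear_vimage linear_block assms(2))
  have "0 \<in> (input_sequences U :: (real^('N \<times> 'm)) set)"
    unfolding eq using assms(3) by (simp add: linear_0[OF linear_block])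
  then show "input_sequences U \<noteq> ({} :: (real^('N \<times> 'm)) set)" by blast
qed

section \<open>Tracking error of the optimizer dynamics\<close>

text \<open>Two degenerate cases deserve attention. If the input to the error dynamics is unbounded, its
  supremum or limit superior is infinite. If the condition number is \<open>1\<close>, the gain vanishes, and the
  product of the two is \<open>0\<close> in the extended reals; the claim then says that every update lands
  on the current optimizer. The recursion \<open>rec'\<close> is phrased with the scaled input \<open>\<gamma>2 * w x k\<close>, which is zero in that
  case, so both cases are covered uniformly.\<close>

theorem theorem4:
  fixes A :: "real^'n^'n" and B :: "real^'m^'n"
    and Q P :: "real^'n^'n" and R :: "real^'m^'m"
    and U :: "(real^'m) set"
    and H :: "real^('N::{finite,linorder} \<times> 'm)^('N \<times> 'm)"
    and G :: "real^'n^('N \<times> 'm)"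
    and f :: "real^('N \<times> 'm) \<Rightarrow> real^'n \<Rightarrow> real"
    and Z :: "(real^('N \<times> 'm)) set"
    and S :: "real^'n \<Rightarrow> real^('N \<times> 'm)"
    and \<alpha> \<eta> b \<gamma>2 :: real and l :: nat
    and optimizer_dynamics :: "(nat \<Rightarrow> real^('N \<times> 'm)) \<Rightarrow> (nat \<Rightarrow> real^'n) \<Rightarrow> bool"
    and err :: "(nat \<Rightarrow> real^('N \<times> 'm)) \<Rightarrow> (nat \<Rightarrow> real^'n) \<Rightarrow> nat \<Rightarrow> real^('N \<times> 'm)"
    and dx :: "(nat \<Rightarrow> real^'n) \<Rightarrow> nat \<Rightarrow> real^'n"
  assumes "stabilizable A B" and "pos_def R" and "pos_def Q" and "pos_def P"
    and "riccati A B Q R P"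
    and "closed U" and "convex U" and "0 \<in> interior U"
    and "l \<ge> 1"
    and H: "H = qp_H A B Q R P"
    and G: "G = qp_G A B Q P"
    and f: "f = cost A B Q R P"
    and Z: "Z = input_sequences U"
    and S: "S = minimizer f Z"
    and \<alpha>: "\<alpha> = 1 / (lambda_max H + lambda_min H)"
    and \<eta>: "\<eta> = (cond_number H - 1) / (cond_number H + 1)"
    and b: "b = norm2 (matrix_inv (matrix_sqrt H))"
    and \<gamma>2: "\<gamma>2 = b * \<eta> ^ l / (1 - \<eta> ^ l)"
    and optimizer_dynamics:
      "\<And>z x. optimizer_dynamics z x \<longleftrightarrow> (\<forall>k\<ge>1. z k = proj_grad l \<alpha> f Z (z (k - 1)) (x k))"
    and err: "\<And>z x k. err z x k = z k - S (x k)"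
    and dx: "\<And>x k. dx x k = x (k + 1) - x k"
  shows "input_to_state_stable {(err z x, dx x) | z x. optimizer_dynamics z x} \<and>
    (\<forall>z x. optimizer_dynamics z x \<longrightarrow>
       (\<forall>k. ereal (norm (err z x k))
          \<le> ereal (\<eta> ^ (k * l) * norm (err z x 0))
            + ereal \<gamma>2 * (SUP j. ereal (wnorm (matrix_inv H) (G *v dx x j)))) \<and>
       limsup (\<lambda>k. ereal (norm (err z x k)))
          \<le> ereal \<gamma>2 * limsup (\<lambda>k. ereal (wnorm (matrix_inv H) (G *v dx x k))))"
proof -
  have pH: "pos_def H"
    unfolding H by (rule pos_def_qp_H) fact+
  have "0 \<in> U" using \<open>0 \<in> interior U\<close> interior_subset by blast
  then have Z': "closed Z" "convex Z" "Z \<noteq> {}"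
    unfolding Z using input_sequences_closed_convex[of U] \<open>closed U\<close> \<open>convex U\<close> by auto
  have \<eta>': "\<eta> = contraction_factor H" by (simp add: \<eta> contraction_factor_def)
  define q where "q = \<eta> ^ l"
  have q: "0 \<le> q" "q < 1"
    using contraction_factor_bounds[OF pH] \<open>l \<ge> 1\<close> by (auto simp: q_def \<eta>' power_less_one_iff)
  have b0: "0 \<le> b"
    unfolding b norm2_def by (rule onorm_pos_le) simp
  have f': "f w x = w \<bullet> (H *v w) + 2 * (w \<bullet> (G *v x)) + x \<bullet> (qp_W TYPE('N) A Q P *v x)" for w x
    unfolding f H G by (rule cost_eq_quadratic) fact+
  have S': "S x \<in> Z \<and> qp_step H Z (G *v x) (S x) = S x \<and>
      (\<forall>w\<in>Z. 0 \<le> (H *v S x + G *v x) \<bullet> (w - S x))" for x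
  proof -
    obtain s where s: "s \<in> Z" "qp_step H Z (G *v x) s = s"
      "\<And>w. w \<in> Z \<Longrightarrow> 0 \<le> (H *v s + G *v x) \<bullet> (w - s)"
      using qp_step_fixed_point[OF pH Z', of "G *v x"] by blast
    have "S x = s"
      unfolding S by (rule minimizer_eqI[where f = f and x = x, OF pH f'[of _ x] s(1,3)])
    then show ?thesis using s by simp
  qed
  define w where "w x k = wnorm (matrix_inv H) (G *v dx x k)" for x k
  have w: "w x k = norm (matrix_inv (matrix_sqrt H) *v (G *v dx x k))" for x k
    unfolding w_def by (rule wnorm_matrix_inv_eq_norm[OF pH])
  have w0: "0 \<le> w x k" for x k by (simp add: w)
  \<comment> \<open>Contraction towards the new optimizer, plus the displacement of the optimizer between samples.\<close>
  have rec: "norm (err z x (Suc k)) \<le> q * norm (err z x k) + q * b * w x k"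
    if "optimizer_dynamics z x" for z x k
  proof -
    let ?s = "S (x (Suc k))"
    have "z (Suc k) = (qp_step H Z (G *v x (Suc k)) ^^ l) (z k)"
      using that proj_grad_quadratic[where f = f and x = "x (Suc k)" and Z = Z, OF _ f'[of _ "x (Suc k)"]] pH
      by (simp add: optimizer_dynamics \<alpha> pos_def_def)
    then have step: "norm (err z x (Suc k)) \<le> q * norm (z k - ?s)"
      using qp_step_funpow_contraction[OF pH Z', of "G *v x (Suc k)" ?s l "z k"] S'
      by (simp add: err q_def \<eta>')
    have "wnorm H (S (x k) - ?s) \<le> wnorm (matrix_inv H) (G *v x (Suc k) - G *v x k)"
      using S' by (intro solution_lipschitz[OF pH, of _ Z]) auto
    then have "wnorm H (S (x k) - ?s) \<le> w x k"
      by (simp add: w_def dx matrix_vector_mult_diff_distrib)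
    then have "b * wnorm H (S (x k) - ?s) \<le> b * w x k"
      using b0 by (rule mult_left_mono)
    moreover have "norm (S (x k) - ?s) \<le> b * wnorm H (S (x k) - ?s)"
      unfolding b by (rule norm_le_wnorm[OF pH])
    moreover have "norm (z k - ?s) \<le> norm (err z x k) + norm (S (x k) - ?s)"
      using norm_triangle_ineq[of "z k - S (x k)" "S (x k) - ?s"] by (simp add: err)
    ultimately have "q * norm (z k - ?s) \<le> q * (norm (err z x k) + b * w x k)"
      using q(1) by (intro mult_left_mono) linarith+
    with step show ?thesis by (simp add: distrib_left)
  qed
  \<comment> \<open>The gain is the fixed level of the recursion for a constant unit input.\<close>
  have \<gamma>2': "\<gamma>2 * (1 - q) = q * b" "0 \<le> \<gamma>2"
    using q b0 by (simp_all add: \<gamma>2 q_def[symmetric])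
  have rec': "norm (err z x (Suc k)) \<le> q * norm (err z x k) + (1 - q) * (\<gamma>2 * w x k)"
    if "optimizer_dynamics z x" for z x k
  proof -
    have "(1 - q) * (\<gamma>2 * w x k) = \<gamma>2 * (1 - q) * w x k"
      by (simp only: mult_ac)
    then show ?thesis using rec[OF that, of k] by (simp only: \<gamma>2'(1))
  qed
  show ?thesis
  proof (intro conjI allI impI)
    define L where "L = onorm ((*v) (matrix_inv (matrix_sqrt H) ** G))"
    have L: "w x k \<le> L * norm (dx x k)" for x k
      unfolding w L_def matrix_vector_mul_assoc by (rule onorm) simp
    have L0: "0 \<le> L"
      unfolding L_def by (rule onorm_pos_le) simp
    show "input_to_state_stable {(err z x, dx x) | z x. optimizer_dynamics z x}"
    proof (rule input_to_state_stableI[OF q, of "q * b * L"])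
      show "0 \<le> q * b * L" using q b0 L0 by simp
      fix e d k assume "(e, d) \<in> {(err z x, dx x) | z x. optimizer_dynamics z x}"
      then obtain z x where zx: "optimizer_dynamics z x" "e = err z x" "d = dx x" by blast
      have "q * b * w x k \<le> q * b * (L * norm (dx x k))"
        using q b0 L by (intro mult_left_mono) auto
      with rec[OF zx(1), of k] show "norm (e (Suc k)) \<le> q * norm (e k) + q * b * L * norm (d k)"
        by (simp add: zx mult.assoc)
    qed
  next
    fix z x k assume dyn: "optimizer_dynamics z x"
    define C where "C = ereal \<gamma>2 * (SUP j. ereal (w x j))"
    have C: "ereal (\<gamma>2 * w x j) \<le> C" for j
      unfolding C_def times_ereal.simps(1)[symmetric]
      by (intro ereal_mult_left_mono SUP_upper) (auto simp: \<gamma>2')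
    have C0: "0 \<le> C"
      using C[of 0] w0[of x 0] \<gamma>2'(2) by (metis ereal_less_eq(5) mult_nonneg_nonneg order_trans)
    have "ereal (norm (err z x k)) \<le> ereal (\<eta> ^ (k * l) * norm (err z x 0)) + C"
    proof (cases C)
      \<comment> \<open>An infinite \<open>C\<close> makes the bound trivial, so only a real value needs the recursion.\<close>
      case (real c)
      have "norm (err z x (0 + k)) \<le> c + q ^ k * (norm (err z x 0) - c)"
        using C real q by (intro contraction_recursion[where
              e = "\<lambda>k. norm (err z x k)" and u = "\<lambda>k. \<gamma>2 * w x k"] rec'[OF dyn]) auto
      also have "\<dots> \<le> q ^ k * norm (err z x 0) + c"
        using C0 real q by (simp add: algebra_simps)
      finally show ?thesis
        by (simp add: real q_def power_mult[symmetric] mult.commute)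
    qed (use C0 in auto)
    then show "ereal (norm (err z x k)) \<le> ereal (\<eta> ^ (k * l) * norm (err z x 0))
        + ereal \<gamma>2 * (SUP j. ereal (wnorm (matrix_inv H) (G *v dx x j)))"
      by (simp add: C_def w_def)
  next
    fix z x assume dyn: "optimizer_dynamics z x"
    have "limsup (\<lambda>k. ereal (norm (err z x k))) \<le> limsup (\<lambda>k. ereal (\<gamma>2 * w x k))"
      by (rule limsup_contraction_recursion[where
            e = "\<lambda>k. norm (err z x k)" and u = "\<lambda>k. \<gamma>2 * w x k", OF q rec'[OF dyn]])
    also have "\<dots> = ereal \<gamma>2 * limsup (\<lambda>k. ereal (w x k))"
      using limsup_ereal_mult_left[OF \<gamma>2'(2), of "\<lambda>k. ereal (w x k)"] by simp
    finally show "limsup (\<lambda>k. ereal (norm (err z x k)))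
        \<le> ereal \<gamma>2 * limsup (\<lambda>k. ereal (wnorm (matrix_inv H) (G *v dx x k)))"
      by (simp add: w_def)
  qed
qed

end
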